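(* Let $H$ be a graph with no isolated vertices, let $p\ge0$ and $0\le\epsilon\le1$, and let $W$ be a graphon satisfying $(1-\epsilon)p\leq\int_0^1 W(x_0,y)\,dy\leq (1+\epsilon)p$ for all $x_0\in[0,1]$. If $U=W-p$, then \[\mathrm{Hom}(H,|U|)\leq ((2+\epsilon)p)^{v(H)-2c(H)}\,\mathbb{E}(|U|)^{c(H)}.\]
   Context: A graphon is a symmetric measurable $W:[0,1]^2\to[0,1]$. For symmetric measurable $F:[0,1]^2\to\mathbb R$, $\mathrm{Hom}(H,F)=\int_{[0,1]^{V(H)}}\prod_{uv\in E(H)}F(x_u,x_v)\prod_v dx_v$, and $\mathbb E(|U|)=\int_{[0,1]^2}|U(x,y)|dxdy$. $v(H)$ is the number of vertices. A fractional vertex cover of $H$ is $(c_v)$ with $c_v\ge0$ and $c_v+c_w\ge1$ for all edges $vw$; $c(H)$ is the minimum of $\sum_v c_v$.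
   Formalization: The formal theorem assumes in addition p ≤ 1 (so that |U| ≤ 1); for p > 1 the claim fails, e.g. H = K_3, W = 0, ε = 1, p = 2 gives Hom(H,|U|) = 8 but right-hand side 2^{3/2}. *)

theory Defs
  imports "HOL-Analysis.Analysis"
begin

text \<open>Finite simple graphs: the edges are two-element sets of vertices.\<close>

definition simple_graph :: "'a set \<Rightarrow> 'a set set \<Rightarrow> bool" where
  "simple_graph V E \<longleftrightarrow> finite V \<and> (\<forall>e\<in>E. e \<subseteq> V \<and> card e = 2)"

definition no_isolated_vertices :: "'a set \<Rightarrow> 'a set set \<Rightarrow> bool" where
  "no_isolated_vertices V E \<longleftrightarrow> (\<forall>v\<in>V. \<exists>e\<in>E. v \<in> e)"

definition fractional_vertex_cover :: "'a set \<Rightarrow> 'a set set \<Rightarrow> ('a \<Rightarrow> real) \<Rightarrow> bool" where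
  "fractional_vertex_cover V E c \<longleftrightarrow>
     (\<forall>v\<in>V. 0 \<le> c v) \<and> (\<forall>v\<in>V. \<forall>w\<in>V. {v, w} \<in> E \<longrightarrow> c v + c w \<ge> 1)"

text \<open>The infimum is attained, by compactness, for finite \<^term>\<open>V\<close>; so this is the minimum.\<close>

definition fractional_cover_number :: "'a set \<Rightarrow> 'a set set \<Rightarrow> real" where
  "fractional_cover_number V E = Inf {\<Sum>v\<in>V. c v |c. fractional_vertex_cover V E c}"

text \<open>Kernels are only constrained on the unit square; values elsewhere are irrelevant.
  Measurability is with respect to the Lebesgue measurable sets, which includes all Borel kernels.\<close>

definition symmetric_kernel :: "(real \<Rightarrow> real \<Rightarrow> real) \<Rightarrow> bool" where
  "symmetric_kernel F \<longleftrightarrow>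
     (\<lambda>(x, y). F x y) \<in> borel_measurable (lebesgue_on ({0..1} \<times> {0..1})) \<and>
     (\<forall>x\<in>{0..1}. \<forall>y\<in>{0..1}. F x y = F y x)"

definition graphon :: "(real \<Rightarrow> real \<Rightarrow> real) \<Rightarrow> bool" where
  "graphon W \<longleftrightarrow> symmetric_kernel W \<and> (\<forall>x\<in>{0..1}. \<forall>y\<in>{0..1}. W x y \<in> {0..1})"

text \<open>The factor \<open>F(x\<^sub>u, x\<^sub>v)\<close> of an unordered edge \<open>e = uv\<close>; well defined
  because \<^term>\<open>F\<close> is symmetric (see \<open>edge_factor_eq\<close>).\<close>

definition edge_factor :: "(real \<Rightarrow> real \<Rightarrow> real) \<Rightarrow> ('a \<Rightarrow> real) \<Rightarrow> 'a set \<Rightarrow> real" where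
  "edge_factor F x e = (THE r. \<exists>u v. e = {u, v} \<and> r = F (x u) (x v) \<and> u \<noteq> v)"

lemma edge_factor_eq:
  assumes "u \<noteq> v" and "F (x u) (x v) = F (x v) (x u)"
  shows "edge_factor F x {u, v} = F (x u) (x v)"
  unfolding edge_factor_def
proof (rule the_equality)
  show "\<exists>u' v'. {u, v} = {u', v'} \<and> F (x u) (x v) = F (x u') (x v') \<and> u' \<noteq> v'"
    using assms(1) by blast
next
  fix r assume "\<exists>u' v'. {u, v} = {u', v'} \<and> r = F (x u') (x v') \<and> u' \<noteq> v'"
  then show "r = F (x u) (x v)"
    using assms(2) by (auto simp: doubleton_eq_iff)
qed

text \<open>The completion makes the product measure Lebesgue measure on \<open>[0,1]\<^sup>V\<close>, so that
  the integrand is measurable for every Lebesgue measurable kernel.\<close>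

definition Hom :: "'a set \<Rightarrow> 'a set set \<Rightarrow> (real \<Rightarrow> real \<Rightarrow> real) \<Rightarrow> real" where
  "Hom V E F =
     (LINT x|completion (Pi\<^sub>M V (\<lambda>_. restrict_space lborel {0..1})). (\<Prod>e\<in>E. edge_factor F x e))"

definition mean_abs :: "(real \<Rightarrow> real \<Rightarrow> real) \<Rightarrow> real" where
  "mean_abs U = (LINT z:{0..1} \<times> {0..1}|lebesgue. \<bar>U (fst z) (snd z)\<bar>)"

text \<open>Real powers of nonnegative numbers with \<open>0\<^sup>0 = 1\<close>, whereas \<open>0 powr 0 = 0\<close>.\<close>

definition rpow :: "real \<Rightarrow> real \<Rightarrow> real" where
  "rpow x a = (if a = 0 then 1 else x powr a)"

end

theory Submission
  imports Defs "HOL-Probability.Infinite_Product_Measure"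
begin

text \<open>
  Call a permutation \<open>\<pi>\<close> of a vertex set \<open>T\<close> admissible if it moves every vertex along an edge.
  Applied to the neighbourhoods, the defect version of Hall's theorem gives an admissible \<open>\<pi>\<close>
  together with a half-integral fractional vertex cover of weight \<open>|T|/2\<close>; as every admissible
  permutation bounds every fractional cover from below, \<open>c(H) = |T|/2\<close> and \<open>|T|\<close> is maximal.
  By maximality each \<open>v \<notin> T\<close> has a neighbour \<open>h(v) \<in> T\<close>.
  As \<open>|U| \<le> 1\<close>, all edges can be dropped except the edges \<open>h(v)v\<close> and \<open>v\<pi>(v)\<close>, and the
  latter contribute at most \<open>\<Prod>v\<in>T. |U(x\<^sub>v, x\<^bsub>\<pi>(v)\<^esub>)|\<^bsup>1/2\<^esup>\<close>. Integrating out the vertices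
  outside \<open>T\<close> yields a factor \<open>(2+\<epsilon>)p\<close> each. In the remaining product every variable occurs in
  exactly two factors, so a Finner-type inequality bounds its integral by
  \<open>\<Prod>v\<in>T. E(|U|)\<^bsup>1/2\<^esup>\<close>.
\<close>

section \<open>Fractional covers and permutations\<close>

text \<open>Rado's argument: by submodularity, if \<open>N v\<close> has two elements, then one of them can be removed
  without violating the defect condition.\<close>

lemma Hall_defect:
  fixes N :: "'a \<Rightarrow> 'b set"
  assumes "finite V" and "\<And>v. v \<in> V \<Longrightarrow> finite (N v)"
    and "\<And>A. A \<subseteq> V \<Longrightarrow> card A \<le> card (\<Union>(N ` A)) + d"
  shows "\<exists>S \<sigma>. S \<subseteq> V \<and> card V \<le> card S + d \<and> inj_on \<sigma> S \<and> (\<forall>v\<in>S. \<sigma> v \<in> N v)"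
  using assms(2,3)
proof (induction "\<Sum>v\<in>V. card (N v)" arbitrary: N rule: less_induct)
  case less
  show ?case
  proof (cases "\<exists>v\<in>V. \<exists>x\<in>N v. \<exists>y\<in>N v. x \<noteq> y")
    case True
    then obtain v x y where v: "v \<in> V" and xy: "x \<in> N v" "y \<in> N v" "x \<noteq> y"
      by blast
    \<comment> \<open>\<open>R z\<close> deletes the single element \<open>z\<close> from
      \<open>N v\<close>. If some such deletion keeps the defect condition, induction on the total
      size applies; otherwise both \<open>x\<close> and \<open>y\<close> lead to violators.\<close>
    define R where "R z = N(v := N v - {z})" for z
    have finU: "finite (\<Union>(N ` A))" if "A \<subseteq> V" for A
      using that less.prems(1) finite_subset[OF that \<open>finite V\<close>] by auto
    have smaller: "(\<Sum>u\<in>V. card (R z u)) < (\<Sum>u\<in>V. card (N u))" if "z \<in> N v" for z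
    proof (rule sum_strict_mono_ex1[OF \<open>finite V\<close>])
      show "\<forall>u\<in>V. card (R z u) \<le> card (N u)"
        using less.prems(1) by (auto simp: R_def intro!: card_mono)
      show "\<exists>u\<in>V. card (R z u) < card (N u)"
        using v that less.prems(1)[OF v] by (intro bexI[of _ v]) (auto simp: R_def simp del: card_Diff_insert intro!: card_Diff1_less)
    qed
    have reduce: ?thesis
      if z: "z \<in> N v" and H: "\<And>A. A \<subseteq> V \<Longrightarrow> card A \<le> card (\<Union>(R z ` A)) + d" for z
    proof -
      have "finite (R z u)" if "u \<in> V" for u
        using less.prems(1) that v by (auto simp: R_def)
      from less.hyps[OF smaller[OF z] this H] show ?thesis
        by (auto simp: R_def split: if_splits)
    qed
    \<comment> \<open>A violator of \<open>R z\<close> contains \<open>v\<close>, since otherwise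
      \<open>R z\<close> and \<open>N\<close> agree on it. Dropping \<open>v\<close> turns the
      strict violation into the non-strict bound stated here.\<close>
    have witness: "\<exists>A\<subseteq>V. v \<notin> A \<and> card (\<Union>(N ` A) \<union> (N v - {z})) + d \<le> card A"
      if A: "A \<subseteq> V" "\<not> card A \<le> card (\<Union>(R z ` A)) + d" for z A
    proof -
      have "v \<in> A"
      proof (rule ccontr)
        assume "v \<notin> A"
        then have "R z ` A = N ` A"
          by (auto simp: R_def image_iff)
        then show False
          using A less.prems(2) by simp
      qed
      have un: "\<Union>(R z ` A) = \<Union>(N ` (A - {v})) \<union> (N v - {z})"
        using \<open>v \<in> A\<close> by (auto simp: R_def split: if_splits)
      have "card A = Suc (card (A - {v}))"
        using \<open>v \<in> A\<close> finite_subset[OF A(1) \<open>finite V\<close>] by (intro card.remove)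
      then have "card (\<Union>(N ` (A - {v})) \<union> (N v - {z})) + d \<le> card (A - {v})"
        using A(2) unfolding un by linarith
      then show ?thesis
        using A(1) by blast
    qed
    show ?thesis
    proof (rule ccontr)
      assume "\<not> ?thesis"
      then obtain A' B' where "A' \<subseteq> V" "\<not> card A' \<le> card (\<Union>(R x ` A')) + d"
        and "B' \<subseteq> V" "\<not> card B' \<le> card (\<Union>(R y ` B')) + d"
        using reduce xy by meson
      then obtain A B where A: "A \<subseteq> V" "v \<notin> A" "card (\<Union>(N ` A) \<union> (N v - {x})) + d \<le> card A"
        and B: "B \<subseteq> V" "v \<notin> B" "card (\<Union>(N ` B) \<union> (N v - {y})) + d \<le> card B"
        using witness by meson
      let ?X = "\<Union>(N ` A) \<union> (N v - {x})" and ?Y = "\<Union>(N ` B) \<union> (N v - {y})"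
      have fin: "finite ?X" "finite ?Y" "finite A" "finite B"
        using finU A B less.prems(1)[OF v] \<open>finite V\<close> finite_subset by auto
      \<comment> \<open>As \<open>x \<noteq> y\<close>, each of \<open>?X\<close> and
        \<open>?Y\<close> supplies the element of \<open>N v\<close> that the other lacks. The extra
        vertex \<open>v\<close> thus comes for free on the right, and submodularity fails by exactly
        this one.\<close>
      have un: "?X \<union> ?Y = \<Union>(N ` insert v (A \<union> B))"
        using xy by auto
      have "card (insert v (A \<union> B)) \<le> card (?X \<union> ?Y) + d"
        unfolding un using A B v by (intro less.prems(2)) auto
      moreover have "card (A \<inter> B) \<le> card (\<Union>(N ` (A \<inter> B))) + d"
        using A by (intro less.prems(2)) auto
      moreover have "card (\<Union>(N ` (A \<inter> B))) \<le> card (?X \<inter> ?Y)"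
        using fin by (intro card_mono) auto
      moreover have "card (?X \<union> ?Y) + card (?X \<inter> ?Y) = card ?X + card ?Y"
        using fin card_Un_Int by metis
      moreover have "card (A \<union> B) + card (A \<inter> B) = card A + card B"
        using fin card_Un_Int by metis
      moreover have "card (insert v (A \<union> B)) = Suc (card (A \<union> B))"
        using A B fin by simp
      ultimately show False
        using A B by linarith
    qed
  next
    case False
    \<comment> \<open>Every \<open>N v\<close> now has at most one element, so sending each
      \<open>u\<close> in \<open>U\<close> to some vertex whose set contains it is injective; the
      inverse of this map is the matching.\<close>
    define U where "U = \<Union>(N ` V)"
    have "\<forall>u\<in>U. \<exists>v\<in>V. u \<in> N v"
      by (auto simp: U_def)
    then obtain f where f: "\<And>u. u \<in> U \<Longrightarrow> f u \<in> V \<and> u \<in> N (f u)"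
      by metis
    have inj: "inj_on f U"
      using f False by (intro inj_onI) metis
    show ?thesis
    proof (intro exI conjI ballI)
      show "f ` U \<subseteq> V"
        using f by blast
      show "card V \<le> card (f ` U) + d"
        using less.prems(2)[of V] card_image[OF inj] by (simp add: U_def)
      show "inj_on (the_inv_into U f) (f ` U)"
        by (rule inj_on_the_inv_into[OF inj])
      show "the_inv_into U f v \<in> N v" if "v \<in> f ` U" for v
        using that f the_inv_into_f_f[OF inj] by auto
    qed
  qed
qed

text \<open>A maximal path of the functional graph of \<open>\<sigma>\<close> is cut into 2-cycles, starting from its
  initial vertex.\<close>

lemma partial_injection_to_permutation:
  fixes adj :: "'a \<Rightarrow> 'a \<Rightarrow> bool"
  assumes "finite S" and "inj_on \<sigma> S" and "\<And>v. v \<in> S \<Longrightarrow> adj v (\<sigma> v)"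
    and "symp adj" and "irreflp adj"
  shows "\<exists>T \<pi>. T \<subseteq> S \<union> \<sigma> ` S \<and> card S \<le> card T \<and> bij_betw \<pi> T T \<and> (\<forall>v\<in>T. adj v (\<pi> v))"
  using assms(1-3)
proof (induction "card S" arbitrary: S rule: less_induct)
  case less
  show ?case
  proof (cases "S \<subseteq> \<sigma> ` S")
    case True
    then have "\<sigma> ` S = S"
      using less.prems by (metis card_image card_subset_eq finite_imageI)
    then show ?thesis
      using less.prems by (intro exI[of _ S] exI[of _ \<sigma>]) (auto simp: bij_betw_def)
  next
    case False
    then obtain v where v: "v \<in> S" "v \<notin> \<sigma> ` S"
      by blast
    define w where "w = \<sigma> v"
    have vw: "adj v w" "adj w v" "v \<noteq> w"
      using less.prems(3)[OF v(1)] assms(4,5) by (auto simp: w_def sympD irreflpD)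
    \<comment> \<open>The first edge \<open>vw\<close> of the path becomes a 2-cycle:
      \<open>T\<close> gains two vertices while \<open>S\<close> loses at most two. If
      \<open>w\<close> lies outside \<open>S\<close>, only \<open>v\<close> is lost.\<close>
    define S' where "S' = S - {v, w}"
    have "card S' < card S"
      using v less.prems(1) by (auto simp: S'_def intro!: psubset_card_mono)
    moreover have "finite S'" "inj_on \<sigma> S'" "\<And>u. u \<in> S' \<Longrightarrow> adj u (\<sigma> u)"
      using less.prems by (auto simp: S'_def intro: inj_on_subset)
    ultimately obtain T \<pi> where T: "T \<subseteq> S' \<union> \<sigma> ` S'" "card S' \<le> card T" "bij_betw \<pi> T T"
      "\<forall>v\<in>T. adj v (\<pi> v)"
      using less.hyps by blast
    \<comment> \<open>By injectivity \<open>v\<close> is the only preimage of \<open>w\<close>, and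
      it has been removed; so the new 2-cycle is disjoint from \<open>T\<close>.\<close>
    have "w \<notin> \<sigma> ` S'"
      using less.prems(2) v(1) by (auto simp: S'_def w_def inj_on_def)
    then have notin: "v \<notin> T" "w \<notin> T"
      using T(1) v by (auto simp: S'_def)
    have "finite T"
      using T(1) \<open>finite S'\<close> finite_subset by blast
    have "card S \<le> card S' + card {v, w}"
      using diff_card_le_card_Diff[of "{v, w}" S] unfolding S'_def by simp
    then have "card S \<le> card (insert v (insert w T))"
      using T(2) notin vw(3) \<open>finite T\<close> by simp
    moreover have "bij_betw (\<pi>(v := w, w := v)) (insert v (insert w T)) (insert v (insert w T))"
    proof -
      have "bij_betw (\<pi>(v := w, w := v)) T T"
        using T(3) notin by (subst bij_betw_cong[of T _ \<pi>]) auto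
      moreover have "bij_betw (\<pi>(v := w, w := v)) {v, w} {v, w}"
        using vw(3) by (auto simp: bij_betw_def inj_on_def)
      ultimately have "bij_betw (\<pi>(v := w, w := v)) (T \<union> {v, w}) (T \<union> {v, w})"
        using notin by (intro bij_betw_combine) auto
      then show ?thesis
        by (simp add: insert_commute)
    qed
    moreover have "insert v (insert w T) \<subseteq> S \<union> \<sigma> ` S"
      using T(1) v(1) by (auto simp: S'_def w_def)
    moreover have "\<forall>u\<in>insert v (insert w T). adj u ((\<pi>(v := w, w := v)) u)"
      using T(4) vw notin by auto
    ultimately show ?thesis
      by blast
  qed
qed

text \<open>In a simple graph such a \<open>\<pi>\<close> has no fixed points, so its orbits
  partition \<open>T\<close> into single edges (2-cycles) and graph cycles of length at least
  three.\<close>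

definition adj_permutation :: "'a set \<Rightarrow> 'a set set \<Rightarrow> 'a set \<Rightarrow> ('a \<Rightarrow> 'a) \<Rightarrow> bool" where
  "adj_permutation V E T \<pi> \<longleftrightarrow> T \<subseteq> V \<and> bij_betw \<pi> T T \<and> (\<forall>v\<in>T. {v, \<pi> v} \<in> E)"

text \<open>Weak duality: summing the cover inequality over the pairs \<open>v\<close>,
  \<open>\<pi> v\<close> counts each vertex of \<open>T\<close> twice, because \<open>\<pi>\<close>
  is a bijection.\<close>

lemma adj_permutation_le_cover:
  assumes "simple_graph V E" and "adj_permutation V E T \<pi>" and "fractional_vertex_cover V E c"
  shows "real (card T) / 2 \<le> (\<Sum>v\<in>V. c v)"
proof -
  have fin: "finite V" and TV: "T \<subseteq> V" and bij: "bij_betw \<pi> T T"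
    using assms(1,2) by (auto simp: simple_graph_def adj_permutation_def)
  have "\<pi> v \<in> V \<and> {v, \<pi> v} \<in> E" if "v \<in> T" for v
    using assms(2) TV bij_betwE[OF bij] that by (auto simp: adj_permutation_def)
  then have edge: "1 \<le> c v + c (\<pi> v)" if "v \<in> T" for v
    using assms(3) TV that by (auto simp: fractional_vertex_cover_def)
  have "real (card T) = (\<Sum>v\<in>T. 1)"
    by simp
  also have "\<dots> \<le> (\<Sum>v\<in>T. c v + c (\<pi> v))"
    by (intro sum_mono edge)
  also have "\<dots> = 2 * (\<Sum>v\<in>T. c v)"
    using sum.reindex_bij_betw[OF bij, of c] by (simp add: sum.distrib)
  also have "(\<Sum>v\<in>T. c v) \<le> (\<Sum>v\<in>V. c v)"
    using assms(3) fin TV by (intro sum_mono2) (auto simp: fractional_vertex_cover_def)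
  finally show ?thesis
    by simp
qed

text \<open>Strong duality: a set \<open>A\<close> of largest defect \<open>d\<close> limits the
  matching to about \<open>card V - d\<close> vertices and at the same time defines a cover of
  weight \<open>(card V - d) / 2\<close>.\<close>

lemma exists_permutation_and_cover:
  assumes G: "simple_graph V E"
  obtains T \<pi> c where "adj_permutation V E T \<pi>" and "fractional_vertex_cover V E c"
    and "(\<Sum>v\<in>V. c v) \<le> real (card T) / 2"
proof -
  have fin: "finite V"
    using G by (simp add: simple_graph_def)
  define N where "N v = {u. {v, u} \<in> E}" for v
  have NV: "N v \<subseteq> V" for v
    using G by (auto simp: N_def simple_graph_def)
  have finN: "finite (N v)" for v
    using NV fin finite_subset by blast
  let ?def = "\<lambda>A. card A - card (\<Union>(N ` A))"
  \<comment> \<open>The subtraction is truncated, so \<open>d = 0\<close> says only that Hall's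
    condition holds. In that case \<open>A\<close> need not give a cheap cover, and the constant
    \<open>1 / 2\<close> is used instead.\<close>
  define d where "d = Max (?def ` Pow V)"
  have "d \<in> ?def ` Pow V"
    unfolding d_def using fin by (intro Max_in) auto
  then obtain A where A: "A \<subseteq> V" and dA: "d = card A - card (\<Union>(N ` A))"
    by auto
  have "card B \<le> card (\<Union>(N ` B)) + d" if "B \<subseteq> V" for B
  proof -
    have "?def B \<le> d"
      unfolding d_def using that fin by (intro Max_ge) auto
    then show ?thesis
      by linarith
  qed
  from Hall_defect[OF fin finN this] obtain S \<sigma> where S: "S \<subseteq> V" "card V \<le> card S + d"
    "inj_on \<sigma> S" "\<forall>v\<in>S. {v, \<sigma> v} \<in> E"
    by (auto simp: N_def)
  have "symp (\<lambda>u v. {u, v} \<in> E)" "irreflp (\<lambda>u v. {u, v} \<in> E)"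
    using G by (auto simp: symp_def irreflp_def insert_commute simple_graph_def)
  then obtain T \<pi> where T: "T \<subseteq> S \<union> \<sigma> ` S" "card S \<le> card T" "bij_betw \<pi> T T" "\<forall>v\<in>T. {v, \<pi> v} \<in> E"
    using partial_injection_to_permutation[of S \<sigma> "\<lambda>u v. {u, v} \<in> E"] S fin finite_subset by blast
  have "\<sigma> ` S \<subseteq> V"
    using S(4) NV by (auto simp: N_def)
  then have "T \<subseteq> V"
    using T(1) S(1) by blast
  then have perm: "adj_permutation V E T \<pi>"
    using T by (auto simp: adj_permutation_def)
  show thesis
  proof (cases "d = 0")
    case True
    have "fractional_vertex_cover V E (\<lambda>_. 1 / 2)"
      by (simp add: fractional_vertex_cover_def)
    then show thesis
      using S T True by (intro that[OF perm]) auto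
  next
    case False
    \<comment> \<open>For an edge \<open>vw\<close>, if \<open>v\<close> lies in \<open>A\<close>
      then \<open>w\<close> lies in its neighbourhood, and vice versa; so each of the two directions
      contributes at least \<open>1 / 2\<close>.\<close>
    define c :: "'a \<Rightarrow> real" where
      "c v = (indicator (- A) v + indicator (\<Union>(N ` A)) v) / 2" for v
    have "fractional_vertex_cover V E c"
      by (auto simp: fractional_vertex_cover_def c_def indicator_def N_def insert_commute)
    moreover have "(\<Sum>v\<in>V. c v) \<le> real (card T) / 2"
    proof -
      have sum_indicator: "(\<Sum>v\<in>V. indicator B v) = real (card (V \<inter> B))" for B
        using fin by (simp add: indicator_def sum_of_bool_eq)
      have UV: "\<Union>(N ` A) \<subseteq> V"
        using NV by blast
      have "(\<Sum>v\<in>V. c v) = ((\<Sum>v\<in>V. indicator (- A) v) + (\<Sum>v\<in>V. indicator (\<Union>(N ` A)) v)) / 2"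
        by (simp add: c_def sum_divide_distrib[symmetric] sum.distrib)
      also have "\<dots> = (real (card (V - A)) + real (card (\<Union>(N ` A)))) / 2"
        unfolding sum_indicator Int_absorb1[OF UV] Diff_eq ..
      also have "\<dots> \<le> real (card T) / 2"
      proof -
        have "card (V - A) = card V - card A"
          using fin A finite_subset by (intro card_Diff_subset) auto
        then have "card (V - A) + card (\<Union>(N ` A)) \<le> card T"
          using S(2) T(2) dA False card_mono[OF fin A] by linarith
        then show ?thesis
          by (simp add: divide_right_mono flip: of_nat_add)
      qed
      finally show ?thesis .
    qed
    ultimately show thesis
      by (intro that[OF perm])
  qed
qed

text \<open>By weak duality the permutation and the cover of equal weight are both optimal.
  Optimality of \<open>T\<close> also forces every outside vertex to have a neighbour in
  \<open>T\<close>.\<close>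

lemma fractional_cover_number_eq:
  assumes G: "simple_graph V E" and "no_isolated_vertices V E"
  obtains T \<pi> h where "adj_permutation V E T \<pi>" and "fractional_cover_number V E = real (card T) / 2"
    and "\<And>v. v \<in> V - T \<Longrightarrow> h v \<in> T \<and> {h v, v} \<in> E"
proof -
  obtain T \<pi> c where perm: "adj_permutation V E T \<pi>" and c: "fractional_vertex_cover V E c"
    and le: "(\<Sum>v\<in>V. c v) \<le> real (card T) / 2"
    using exists_permutation_and_cover[OF G] .
  have "fractional_cover_number V E = real (card T) / 2"
    unfolding fractional_cover_number_def
  proof (rule cInf_eq_minimum)
    have "(\<Sum>v\<in>V. c v) = real (card T) / 2"
      using le adj_permutation_le_cover[OF G perm c] by simp
    then show "real (card T) / 2 \<in> {\<Sum>v\<in>V. c v |c. fractional_vertex_cover V E c}"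
      using c by (intro CollectI exI[of _ c]) simp
  qed (use adj_permutation_le_cover[OF G perm] in auto)
  moreover have "\<exists>u\<in>T. {u, v} \<in> E" if v: "v \<in> V - T" for v
  proof (rule ccontr)
    assume no: "\<not> ?thesis"
    obtain e where e: "e \<in> E" "v \<in> e"
      using assms(2) v by (auto simp: no_isolated_vertices_def)
    then have "card e = 2" "e \<subseteq> V"
      using G by (auto simp: simple_graph_def)
    then have "card (e - {v}) = 1"
      using e(2) by simp
    then obtain u where "e - {v} = {u}"
      by (auto simp: card_1_singleton_iff)
    then have "e = {u, v}" "u \<noteq> v"
      using e(2) by auto
    then have u: "{u, v} \<in> E" "u \<noteq> v" "u \<in> V"
      using e(1) \<open>e \<subseteq> V\<close> by auto
    then have "u \<notin> T"
      using no by blast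
    have fin: "finite T"
      using perm G finite_subset by (auto simp: adj_permutation_def simple_graph_def)
    \<comment> \<open>If \<open>v\<close> had no neighbour in \<open>T\<close>, the edge
      \<open>uv\<close> could be added as a 2-cycle, and the larger permutation would exceed the
      weight of the cover \<open>c\<close>.\<close>
    let ?\<pi> = "\<pi>(u := v, v := u)" and ?T = "T \<union> {u, v}"
    have "bij_betw ?\<pi> T T"
      using perm \<open>u \<notin> T\<close> v by (subst bij_betw_cong[of T _ \<pi>]) (auto simp: adj_permutation_def)
    moreover have "bij_betw ?\<pi> {u, v} {u, v}"
      using u(2) by (auto simp: bij_betw_def inj_on_def)
    ultimately have "bij_betw ?\<pi> ?T ?T"
      using \<open>u \<notin> T\<close> v by (intro bij_betw_combine) auto
    then have "adj_permutation V E ?T ?\<pi>"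
      using perm u v \<open>u \<notin> T\<close> by (auto simp: adj_permutation_def insert_commute)
    from adj_permutation_le_cover[OF G this c] have "card ?T \<le> card T"
      using le by simp
    then show False
      using fin u(2) \<open>u \<notin> T\<close> v by simp
  qed
  then obtain h where "\<And>v. v \<in> V - T \<Longrightarrow> h v \<in> T \<and> {h v, v} \<in> E"
    by metis
  ultimately show thesis
    using that perm by blast
qed

text \<open>Discarding factors that are at most 1 only increases the product. An edge of a 2-cycle
  occurs twice among the square roots and is recovered exactly; an edge of a longer cycle occurs
  once, where \<open>a e\<close> is at most its square root.\<close>

lemma prod_edges_le:
  fixes a :: "'a set \<Rightarrow> real"
  assumes G: "simple_graph V E" and perm: "adj_permutation V E T \<pi>"
    and h: "\<And>v. v \<in> V - T \<Longrightarrow> h v \<in> T \<and> {h v, v} \<in> E"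
    and a: "\<And>e. e \<in> E \<Longrightarrow> 0 \<le> a e \<and> a e \<le> 1"
  shows "(\<Prod>e\<in>E. a e) \<le> (\<Prod>v\<in>V - T. a {h v, v}) * (\<Prod>v\<in>T. sqrt (a {v, \<pi> v}))"
proof -
  have TV: "T \<subseteq> V" and bij: "bij_betw \<pi> T T"
    and \<pi>: "\<And>v. v \<in> T \<Longrightarrow> {v, \<pi> v} \<in> E"
    using perm by (auto simp: adj_permutation_def)
  have "finite V" and "E \<subseteq> Pow V"
    using G by (auto simp: simple_graph_def)
  then have fin: "finite V" "finite T" and finE: "finite E"
    using finite_subset[OF TV] finite_subset[of E "Pow V"] by auto
  let ?E1 = "(\<lambda>v. {h v, v}) ` (V - T)" and ?E2 = "(\<lambda>v. {v, \<pi> v}) ` T"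
  have inj: "inj_on (\<lambda>v. {h v, v}) (V - T)"
  proof (rule inj_onI)
    fix u v assume "u \<in> V - T" "v \<in> V - T" "{h u, u} = {h v, v}"
    then show "u = v"
      using h[of v] by (auto simp: doubleton_eq_iff)
  qed
  have disj: "?E1 \<inter> ?E2 = {}"
    using bij_betwE[OF bij] by (auto simp: doubleton_eq_iff)
  have sub: "?E1 \<union> ?E2 \<subseteq> E"
    using h \<pi> by blast
  have "(\<Prod>e\<in>E. a e) = (\<Prod>e\<in>E - (?E1 \<union> ?E2). a e) * (\<Prod>e\<in>?E1 \<union> ?E2. a e)"
    by (rule prod.subset_diff[OF sub finE])
  also have "\<dots> \<le> 1 * (\<Prod>e\<in>?E1 \<union> ?E2. a e)"
    by (intro mult_right_mono prod_nonneg prod_le_1 ballI) (use a sub in blast)+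
  also have "\<dots> = (\<Prod>v\<in>V - T. a {h v, v}) * (\<Prod>e\<in>?E2. a e)"
    by (subst prod.union_disjoint[OF _ _ disj]) (use fin in \<open>simp_all add: prod.reindex[OF inj]\<close>)
  also have "(\<Prod>e\<in>?E2. a e) \<le> (\<Prod>e\<in>?E2. \<Prod>v\<in>{v \<in> T. {v, \<pi> v} = e}. sqrt (a {v, \<pi> v}))"
  proof (intro prod_mono conjI)
    fix e assume e: "e \<in> ?E2"
    then have "e \<in> E"
      using sub by blast
    then have e01: "0 \<le> a e" "a e \<le> 1" and "card e = 2"
      using a G by (auto simp: simple_graph_def)
    show "0 \<le> a e"
      by fact
    \<comment> \<open>A vertex whose edge to its image is \<open>e\<close> is an endpoint of
      \<open>e\<close>, so at most two square roots belong to \<open>e\<close>.\<close>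
    have "card {v \<in> T. {v, \<pi> v} = e} \<le> card e"
      using \<open>card e = 2\<close> by (intro card_mono) (auto intro: card_ge_0_finite)
    then have "sqrt (a e) ^ 2 \<le> sqrt (a e) ^ card {v \<in> T. {v, \<pi> v} = e}"
      using e01 \<open>card e = 2\<close> by (intro power_decreasing) auto
    also have "\<dots> = (\<Prod>v\<in>{v \<in> T. {v, \<pi> v} = e}. sqrt (a {v, \<pi> v}))"
      by (subst prod_constant[symmetric]) (intro prod.cong, auto)
    finally show "a e \<le> (\<Prod>v\<in>{v \<in> T. {v, \<pi> v} = e}. sqrt (a {v, \<pi> v}))"
      using e01 by simp
  qed
  also have "\<dots> = (\<Prod>v\<in>T. sqrt (a {v, \<pi> v}))"
    using fin(2) by (rule prod.image_gen[symmetric])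
  finally show ?thesis
    using h a by (auto intro!: mult_left_mono prod_nonneg)
qed

section \<open>A Finner-type inequality\<close>

text \<open>The case \<open>top\<close> is separate because \<open>enn2real top = 0\<close>. With
  it, root and square are mutually inverse on all of \<open>ennreal\<close>, so Cauchy--Schwarz
  needs no finiteness assumptions.\<close>

definition ennreal_sqrt :: "ennreal \<Rightarrow> ennreal" where
  "ennreal_sqrt z = (if z = top then top else ennreal (sqrt (enn2real z)))"

lemma ennreal_sqrt_measurable [measurable]: "ennreal_sqrt \<in> borel_measurable borel"
  unfolding ennreal_sqrt_def by measurable

lemma ennreal_sqrt_ennreal [simp]: "0 \<le> r \<Longrightarrow> ennreal_sqrt (ennreal r) = ennreal (sqrt r)"
  by (simp add: ennreal_sqrt_def)

lemma ennreal_sqrt_1 [simp]: "ennreal_sqrt 1 = 1"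
  using ennreal_sqrt_ennreal[of 1] by simp

lemma ennreal_sqrt_top [simp]: "ennreal_sqrt top = top"
  by (simp add: ennreal_sqrt_def)

lemma ennreal_sqrt_power2 [simp]: "(ennreal_sqrt z)\<^sup>2 = z"
  by (cases z) (auto simp: ennreal_power)

lemma ennreal_sqrt_of_power2 [simp]: "ennreal_sqrt (z\<^sup>2) = z"
  by (cases z) (auto simp: ennreal_power)

lemma ennreal_sqrt_mono: "a \<le> b \<Longrightarrow> ennreal_sqrt a \<le> ennreal_sqrt b"
  by (cases a; cases b) (auto simp: top_unique intro!: ennreal_leI)

lemma ennreal_sqrt_mult: "ennreal_sqrt (a * b) = ennreal_sqrt a * ennreal_sqrt b"
  using ennreal_sqrt_of_power2[of "ennreal_sqrt a * ennreal_sqrt b"]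
  by (simp add: power_mult_distrib)

lemma nn_integral_sqrt_mult_le:
  assumes [measurable]: "a \<in> borel_measurable M" "b \<in> borel_measurable M"
  shows "(\<integral>\<^sup>+y. ennreal_sqrt (a y) * ennreal_sqrt (b y) \<partial>M)
    \<le> ennreal_sqrt (\<integral>\<^sup>+y. a y \<partial>M) * ennreal_sqrt (\<integral>\<^sup>+y. b y \<partial>M)"
  using ennreal_sqrt_mono[OF Cauchy_Schwarz_nn_integral[of "\<lambda>y. ennreal_sqrt (a y)" M "\<lambda>y. ennreal_sqrt (b y)"]]
  by (simp add: ennreal_sqrt_mult)

text \<open>With two factors this is Cauchy--Schwarz; a single factor is paired with the constant 1,
  whose integral is 1 over a probability space.\<close>

lemma (in prob_space) nn_integral_prod_sqrt_le:
  assumes J: "finite J" "card J \<le> 2" and G: "\<And>i. i \<in> J \<Longrightarrow> G i \<in> borel_measurable M"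
  shows "(\<integral>\<^sup>+y. (\<Prod>i\<in>J. ennreal_sqrt (G i y)) \<partial>M) \<le> (\<Prod>i\<in>J. ennreal_sqrt (\<integral>\<^sup>+y. G i y \<partial>M))"
proof -
  consider "card J = 0" | "card J = 1" | "card J = 2"
    using J(2) by linarith
  then show ?thesis
  proof cases
    case 1
    then show ?thesis
      using J(1) by (simp add: emeasure_space_1)
  next
    case 2
    then obtain i where "J = {i}"
      by (auto simp: card_1_singleton_iff)
    then show ?thesis
      using nn_integral_sqrt_mult_le[of "G i" M "\<lambda>_. 1"] G by (simp add: emeasure_space_1)
  next
    case 3
    then obtain i j where "J = {i, j}" "i \<noteq> j"
      by (auto simp: card_2_iff)
    then show ?thesis
      using nn_integral_sqrt_mult_le[of "G i" M "G j"] G by simp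
  qed
qed

lemma product_prob_space_const: "prob_space P \<Longrightarrow> product_prob_space (\<lambda>_. P)"
  by (simp add: product_prob_space_def product_prob_space_axioms_def product_sigma_finite_def
      prob_space_imp_sigma_finite)

text \<open>The coordinates are integrated out one at a time; at each step Cauchy--Schwarz is applied to
  the at most two factors that depend on the current coordinate.\<close>

lemma Finner_inequality_two:
  fixes G :: "'i \<Rightarrow> ('a \<Rightarrow> 'b) \<Rightarrow> ennreal" and D :: "'i \<Rightarrow> 'a set"
  assumes P: "prob_space P" and "finite V" and I: "finite I"
    and "\<And>i. i \<in> I \<Longrightarrow> G i \<in> borel_measurable (Pi\<^sub>M V (\<lambda>_. P))"
    and "\<And>i x x'. i \<in> I \<Longrightarrow> (\<And>v. v \<in> D i \<Longrightarrow> x v = x' v) \<Longrightarrow> G i x = G i x'"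
    and "\<And>v. v \<in> V \<Longrightarrow> card {i \<in> I. v \<in> D i} \<le> 2"
  shows "(\<integral>\<^sup>+x. (\<Prod>i\<in>I. ennreal_sqrt (G i x)) \<partial>Pi\<^sub>M V (\<lambda>_. P))
    \<le> (\<Prod>i\<in>I. ennreal_sqrt (\<integral>\<^sup>+x. G i x \<partial>Pi\<^sub>M V (\<lambda>_. P)))"
  using assms(2,4-6)
proof (induction V arbitrary: G D rule: finite_induct)
  case empty
  interpret product_prob_space "\<lambda>_. P" "{}"
    by (rule product_prob_space_const[OF P])
  show ?case
    by (simp add: nn_integral_empty)
next
  case (insert v V)
  interpret p1: prob_space P by (rule P)
  interpret product_prob_space "\<lambda>_. P" V
    by (rule product_prob_space_const[OF P])
  note G [measurable] = insert.prems(1)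
  define G' where "G' i x = (\<integral>\<^sup>+y. G i (x(v := y)) \<partial>P)" for i x
  have G'_measurable: "G' i \<in> borel_measurable (Pi\<^sub>M V (\<lambda>_. P))" if [simp]: "i \<in> I" for i
    unfolding G'_def by measurable
  have inner: "(\<integral>\<^sup>+y. (\<Prod>i\<in>I. ennreal_sqrt (G i (x(v := y)))) \<partial>P) \<le> (\<Prod>i\<in>I. ennreal_sqrt (G' i x))"
    if x: "x \<in> space (Pi\<^sub>M V (\<lambda>_. P))" for x
  proof -
    define J where "J = {i \<in> I. v \<in> D i}"
    have J: "J \<subseteq> I" "finite J" "card J \<le> 2"
      using I insert.prems(3)[of v] by (auto simp: J_def)
    have const: "G i (x(v := y)) = G i x" if "i \<in> I - J" for i y
      using that by (intro insert.prems(2)) (auto simp: J_def)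
    \<comment> \<open>Total mass 1 makes integration over the new coordinate invisible to the
      factors that do not depend on it.\<close>
    have const': "G' i x = G i x" if "i \<in> I - J" for i
      using const[OF that] by (simp add: G'_def p1.emeasure_space_1)
    have sec: "(\<lambda>y. G i (x(v := y))) \<in> borel_measurable P" if "i \<in> I" for i
      using measurable_comp[OF measurable_component_update[OF x \<open>v \<notin> V\<close>] G[OF that]]
      by (simp add: comp_def)
    have "(\<integral>\<^sup>+y. (\<Prod>i\<in>I. ennreal_sqrt (G i (x(v := y)))) \<partial>P)
      = (\<integral>\<^sup>+y. (\<Prod>i\<in>I - J. ennreal_sqrt (G i x)) * (\<Prod>i\<in>J. ennreal_sqrt (G i (x(v := y)))) \<partial>P)"
      by (simp add: prod.subset_diff[OF J(1) I] const)
    also have "\<dots> = (\<Prod>i\<in>I - J. ennreal_sqrt (G i x)) * (\<integral>\<^sup>+y. (\<Prod>i\<in>J. ennreal_sqrt (G i (x(v := y)))) \<partial>P)"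
      using J(1) sec by (intro nn_integral_cmult borel_measurable_prod_ennreal
        measurable_compose[OF _ ennreal_sqrt_measurable]) auto
    also have "\<dots> \<le> (\<Prod>i\<in>I - J. ennreal_sqrt (G i x)) * (\<Prod>i\<in>J. ennreal_sqrt (G' i x))"
      unfolding G'_def using J sec by (intro mult_left_mono p1.nn_integral_prod_sqrt_le) auto
    also have "\<dots> = (\<Prod>i\<in>I. ennreal_sqrt (G' i x))"
      by (simp add: prod.subset_diff[OF J(1) I] const')
    finally show ?thesis .
  qed
  have "(\<integral>\<^sup>+x. (\<Prod>i\<in>I. ennreal_sqrt (G i x)) \<partial>Pi\<^sub>M (insert v V) (\<lambda>_. P))
    = (\<integral>\<^sup>+x. (\<integral>\<^sup>+y. (\<Prod>i\<in>I. ennreal_sqrt (G i (x(v := y)))) \<partial>P) \<partial>Pi\<^sub>M V (\<lambda>_. P))"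
    using insert.hyps by (intro product_nn_integral_insert) auto
  also have "\<dots> \<le> (\<integral>\<^sup>+x. (\<Prod>i\<in>I. ennreal_sqrt (G' i x)) \<partial>Pi\<^sub>M V (\<lambda>_. P))"
    by (intro nn_integral_mono inner)
  also have "\<dots> \<le> (\<Prod>i\<in>I. ennreal_sqrt (\<integral>\<^sup>+x. G' i x \<partial>Pi\<^sub>M V (\<lambda>_. P)))"
  proof (rule insert.IH[where D = "\<lambda>i. D i - {v}"])
    show "G' i x = G' i x'" if "i \<in> I" "\<And>u. u \<in> D i - {v} \<Longrightarrow> x u = x' u" for i x x'
      unfolding G'_def using that by (intro nn_integral_cong insert.prems(2)[OF that(1)]) auto
    show "card {i \<in> I. u \<in> D i - {v}} \<le> 2" if "u \<in> V" for u
      using insert.prems(3)[of u] that insert.hyps by (cases "u = v") auto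
  qed (rule G'_measurable)
  also have "\<dots> = (\<Prod>i\<in>I. ennreal_sqrt (\<integral>\<^sup>+x. G i x \<partial>Pi\<^sub>M (insert v V) (\<lambda>_. P)))"
    unfolding G'_def using insert.hyps
    by (intro prod.cong refl arg_cong[where f = ennreal_sqrt] product_nn_integral_insert[symmetric]) auto
  finally show ?case .
qed

text \<open>It suffices to compare rectangles, whose preimages are cylinders over two distinct
  coordinates. This carries integrals and null sets between the square and the cube.\<close>

lemma distr_PiM_two_components:
  assumes P: "prob_space P" and uv: "u \<in> V" "v \<in> V" "u \<noteq> v"
  shows "distr (Pi\<^sub>M V (\<lambda>_. P)) (P \<Otimes>\<^sub>M P) (\<lambda>x. (x u, x v)) = P \<Otimes>\<^sub>M P"
proof (rule pair_measure_eqI[symmetric])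
  fix A B assume AB: "A \<in> sets P" "B \<in> sets P"
  have "(\<lambda>x. (x u, x v)) \<in> measurable (Pi\<^sub>M V (\<lambda>_. P)) (P \<Otimes>\<^sub>M P)"
    using uv by measurable
  moreover have "(\<lambda>x. (x u, x v)) -` (A \<times> B) \<inter> space (Pi\<^sub>M V (\<lambda>_. P))
    = prod_emb V (\<lambda>_. P) {u, v} (Pi\<^sub>E {u, v} (\<lambda>w. if w = u then A else B))"
    using uv by (auto simp: prod_emb_def space_PiM restrict_PiE_iff)
  ultimately show "emeasure P A * emeasure P B
    = emeasure (distr (Pi\<^sub>M V (\<lambda>_. P)) (P \<Otimes>\<^sub>M P) (\<lambda>x. (x u, x v))) (A \<times> B)"
    using AB uv P by (simp add: emeasure_distr emeasure_PiM_emb)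
qed (use P prob_space_imp_sigma_finite in auto)

text \<open>The coordinate \<open>x v\<close> enters only the factors indexed by \<open>v\<close>
  and by its preimage under \<open>\<pi>\<close>, so the Finner-type inequality applies.\<close>

lemma nn_integral_prod_permutation_le:
  fixes G :: "'b \<times> 'b \<Rightarrow> ennreal"
  assumes P: "prob_space P" and "finite T" and \<pi>: "bij_betw \<pi> T T" "\<And>v. v \<in> T \<Longrightarrow> \<pi> v \<noteq> v"
    and G [measurable]: "G \<in> borel_measurable (P \<Otimes>\<^sub>M P)"
  shows "(\<integral>\<^sup>+x. (\<Prod>v\<in>T. ennreal_sqrt (G (x v, x (\<pi> v)))) \<partial>Pi\<^sub>M T (\<lambda>_. P))
    \<le> ennreal_sqrt (\<integral>\<^sup>+z. G z \<partial>(P \<Otimes>\<^sub>M P)) ^ card T"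
proof -
  have \<pi>T: "\<pi> v \<in> T" if "v \<in> T" for v
    using bij_betwE[OF \<pi>(1)] that by blast
  have pair: "(\<lambda>x. (x v, x (\<pi> v))) \<in> measurable (Pi\<^sub>M T (\<lambda>_. P)) (P \<Otimes>\<^sub>M P)" if "v \<in> T" for v
    using that \<pi>T[OF that] by measurable
  have "(\<integral>\<^sup>+x. (\<Prod>v\<in>T. ennreal_sqrt (G (x v, x (\<pi> v)))) \<partial>Pi\<^sub>M T (\<lambda>_. P))
    \<le> (\<Prod>v\<in>T. ennreal_sqrt (\<integral>\<^sup>+x. G (x v, x (\<pi> v)) \<partial>Pi\<^sub>M T (\<lambda>_. P)))"
  proof (rule Finner_inequality_two[where D = "\<lambda>v. {v, \<pi> v}", OF P \<open>finite T\<close> \<open>finite T\<close>])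
    show "(\<lambda>x. G (x v, x (\<pi> v))) \<in> borel_measurable (Pi\<^sub>M T (\<lambda>_. P))" if "v \<in> T" for v
      by (rule measurable_compose[OF pair[OF that] G])
    show "card {i \<in> T. v \<in> {i, \<pi> i}} \<le> 2" for v
    proof -
      have "{i \<in> T. v \<in> {i, \<pi> i}} \<subseteq> {v, the_inv_into T \<pi> v}"
        using the_inv_into_f_f[OF bij_betw_imp_inj_on[OF \<pi>(1)]] by auto
      then have "card {i \<in> T. v \<in> {i, \<pi> i}} \<le> card {v, the_inv_into T \<pi> v}"
        by (intro card_mono) auto
      also have "\<dots> \<le> 2"
        by (simp add: card_insert_if)
      finally show ?thesis .
    qed
  qed simp
  also have "\<dots> = (\<Prod>v\<in>T. ennreal_sqrt (\<integral>\<^sup>+z. G z \<partial>(P \<Otimes>\<^sub>M P)))"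
  proof (rule prod.cong[OF refl])
    fix v assume v: "v \<in> T"
    have "(\<integral>\<^sup>+x. G (x v, x (\<pi> v)) \<partial>Pi\<^sub>M T (\<lambda>_. P))
      = (\<integral>\<^sup>+z. G z \<partial>distr (Pi\<^sub>M T (\<lambda>_. P)) (P \<Otimes>\<^sub>M P) (\<lambda>x. (x v, x (\<pi> v))))"
      by (rule nn_integral_distr[symmetric, OF pair[OF v]]) simp
    then show "ennreal_sqrt (\<integral>\<^sup>+x. G (x v, x (\<pi> v)) \<partial>Pi\<^sub>M T (\<lambda>_. P)) = ennreal_sqrt (\<integral>\<^sup>+z. G z \<partial>(P \<Otimes>\<^sub>M P))"
      using distr_PiM_two_components[OF P v \<pi>T[OF v] \<pi>(2)[OF v, symmetric]] by simp
  qed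
  finally show ?thesis
    by simp
qed

text \<open>With the coordinates in \<open>T\<close> fixed, the pendant factors depend on pairwise
  distinct outer coordinates. Their integral therefore factorizes, each part being at most
  \<open>D\<close>.\<close>

lemma nn_integral_prod_pendant_le:
  fixes G :: "'b \<times> 'b \<Rightarrow> ennreal"
  assumes P: "prob_space P" and "finite V" and "T \<subseteq> V"
    and \<pi>: "bij_betw \<pi> T T" "\<And>v. v \<in> T \<Longrightarrow> \<pi> v \<noteq> v"
    and h: "\<And>v. v \<in> V - T \<Longrightarrow> h v \<in> T"
    and G [measurable]: "G \<in> borel_measurable (P \<Otimes>\<^sub>M P)"
    and D: "\<And>a. a \<in> space P \<Longrightarrow> (\<integral>\<^sup>+b. G (a, b) \<partial>P) \<le> D"
  shows "(\<integral>\<^sup>+x. (\<Prod>v\<in>V - T. G (x (h v), x v)) * (\<Prod>v\<in>T. ennreal_sqrt (G (x v, x (\<pi> v)))) \<partial>Pi\<^sub>M V (\<lambda>_. P))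
    \<le> D ^ card (V - T) * ennreal_sqrt (\<integral>\<^sup>+z. G z \<partial>(P \<Otimes>\<^sub>M P)) ^ card T"
proof -
  interpret Q: product_prob_space "\<lambda>_. P" V
    by (rule product_prob_space_const[OF P])
  let ?R = "V - T"
  let ?A = "\<lambda>x. \<Prod>v\<in>T. ennreal_sqrt (G (x v, x (\<pi> v)))"
  have fin: "finite T" "finite ?R" and disj: "T \<inter> ?R = {}" and un: "T \<union> ?R = V"
    using \<open>finite V\<close> \<open>T \<subseteq> V\<close> finite_subset by auto
  have \<pi>T: "\<pi> v \<in> T" if "v \<in> T" for v
    using bij_betwE[OF \<pi>(1)] that by blast
  have pair: "(\<lambda>x. G (x u, x v)) \<in> borel_measurable (Pi\<^sub>M S (\<lambda>_. P))" if "u \<in> S" "v \<in> S" for u v S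
    using that by measurable
  have meas: "?A \<in> borel_measurable (Pi\<^sub>M S (\<lambda>_. P))" if "T \<subseteq> S" for S
    using \<pi>T that by (intro borel_measurable_prod_ennreal measurable_compose[OF _ ennreal_sqrt_measurable] pair) auto
  have "(\<integral>\<^sup>+x. (\<Prod>v\<in>?R. G (x (h v), x v)) * ?A x \<partial>Pi\<^sub>M (T \<union> ?R) (\<lambda>_. P))
    = (\<integral>\<^sup>+x. (\<integral>\<^sup>+y. (\<Prod>v\<in>?R. G (merge T ?R (x, y) (h v), merge T ?R (x, y) v)) * ?A (merge T ?R (x, y))
        \<partial>Pi\<^sub>M ?R (\<lambda>_. P)) \<partial>Pi\<^sub>M T (\<lambda>_. P))"
    using h \<open>T \<subseteq> V\<close>
    by (intro Q.product_nn_integral_fold disj fin borel_measurable_times_ennreal borel_measurable_prod_ennreal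
        pair meas) auto
  \<comment> \<open>Since \<open>h\<close> and \<open>\<pi>\<close> take values in \<open>T\<close>,
    only the second argument of each pendant factor comes from \<open>y\<close>.\<close>
  also have "\<dots> = (\<integral>\<^sup>+x. (\<integral>\<^sup>+y. (\<Prod>v\<in>?R. G (x (h v), y v)) * ?A x \<partial>Pi\<^sub>M ?R (\<lambda>_. P)) \<partial>Pi\<^sub>M T (\<lambda>_. P))"
    using h \<pi>T by (intro nn_integral_cong arg_cong2[where f = "(*)"] prod.cong refl)
      (auto simp: merge_def)
  also have "\<dots> \<le> (\<integral>\<^sup>+x. D ^ card ?R * ?A x \<partial>Pi\<^sub>M T (\<lambda>_. P))"
  proof (rule nn_integral_mono)
    fix x assume x: "x \<in> space (Pi\<^sub>M T (\<lambda>_. P))"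
    have xP: "x (h v) \<in> space P" if "v \<in> ?R" for v
      using x h[OF that] by (auto simp: space_PiM)
    have sec: "(\<lambda>b. G (a, b)) \<in> borel_measurable P" if "a \<in> space P" for a
      using that by measurable
    have "(\<integral>\<^sup>+y. (\<Prod>v\<in>?R. G (x (h v), y v)) * ?A x \<partial>Pi\<^sub>M ?R (\<lambda>_. P))
      = (\<integral>\<^sup>+y. (\<Prod>v\<in>?R. G (x (h v), y v)) \<partial>Pi\<^sub>M ?R (\<lambda>_. P)) * ?A x"
      using sec[OF xP] by (intro nn_integral_multc borel_measurable_prod_ennreal
          measurable_compose[OF measurable_component_singleton]) auto
    also have "(\<integral>\<^sup>+y. (\<Prod>v\<in>?R. G (x (h v), y v)) \<partial>Pi\<^sub>M ?R (\<lambda>_. P)) = (\<Prod>v\<in>?R. \<integral>\<^sup>+b. G (x (h v), b) \<partial>P)"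
      using sec[OF xP] fin by (intro Q.product_nn_integral_prod) auto
    also have "\<dots> \<le> (\<Prod>v\<in>?R. D)"
      using D[OF xP] by (rule prod_mono_ennreal)
    finally show "(\<integral>\<^sup>+y. (\<Prod>v\<in>?R. G (x (h v), y v)) * ?A x \<partial>Pi\<^sub>M ?R (\<lambda>_. P)) \<le> D ^ card ?R * ?A x"
      by (simp add: mult_right_mono)
  qed
  also have "\<dots> = D ^ card ?R * (\<integral>\<^sup>+x. ?A x \<partial>Pi\<^sub>M T (\<lambda>_. P))"
    by (intro nn_integral_cmult meas) simp
  also have "\<dots> \<le> D ^ card ?R * ennreal_sqrt (\<integral>\<^sup>+z. G z \<partial>(P \<Otimes>\<^sub>M P)) ^ card T"
    by (intro mult_left_mono nn_integral_prod_permutation_le P fin \<pi> G) auto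
  finally show ?thesis
    by (simp only: un)
qed

section \<open>Borel majorants of Lebesgue measurable kernels\<close>

text \<open>A preimage under \<open>f\<close> differs from one under \<open>g\<close> only inside a
  null set, all of whose subsets are measurable in the completion.\<close>

lemma borel_measurable_completion_AE_eq:
  assumes g: "g \<in> borel_measurable M" and "AE x in M. f x = g x"
  shows "f \<in> borel_measurable (completion M)"
proof -
  obtain N where N: "N \<in> null_sets M" "{x \<in> space M. f x \<noteq> g x} \<subseteq> N"
    using assms(2) unfolding eventually_ae_filter by blast
  show ?thesis
  proof (rule measurableI)
    fix A :: "'b set" assume A: "A \<in> sets borel"
    have eq: "f -` A \<inter> space M = (g -` A \<inter> space M - N) \<union> (f -` A \<inter> space M \<inter> N)"
      using N(2) by auto
    have 1: "g -` A \<inter> space M - N \<in> sets M"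
      using measurable_sets[OF g A] N(1) by auto
    have 2: "f -` A \<inter> space M \<inter> N \<in> null_sets (completion M)"
      by (rule null_sets_completion_subset[OF Int_lower2 null_sets_completionI[OF N(1)]])
    show "f -` A \<inter> space (completion M) \<in> sets (completion M)"
      unfolding space_completion by (subst eq) (rule sets.Un[OF sets_completionI_sets[OF 1] null_setsD2[OF 2]])
  qed simp
qed

text \<open>Bridge from Bochner integrals over Lebesgue measure to nonnegative integrals of Borel
  versions. Boundedness on a set of finite measure gives integrability, so the Bochner integral is
  not the default 0.\<close>

lemma set_lebesgue_integral_completion:
  fixes f g :: "'a \<Rightarrow> real"
  assumes g: "g \<in> borel_measurable M" and A: "A \<in> sets M" "emeasure M A < \<infinity>"
    and bound: "\<And>x. x \<in> A \<Longrightarrow> 0 \<le> g x \<and> g x \<le> B"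
    and eq: "AE x in M. x \<in> A \<longrightarrow> f x = g x"
  shows "ennreal (LINT x:A|completion M. f x) = (\<integral>\<^sup>+x. ennreal (g x) * indicator A x \<partial>M)"
proof -
  let ?g = "\<lambda>x. indicator A x * g x"
  have g' [measurable]: "?g \<in> borel_measurable M"
    by (intro borel_measurable_times borel_measurable_indicator g A)
  have AE: "AE x in M. indicator A x * f x = ?g x"
    using eq by eventually_elim (auto simp: indicator_def)
  have "(LINT x:A|completion M. f x) = (\<integral>x. ?g x \<partial>completion M)"
    unfolding set_lebesgue_integral_def real_scaleR_def
    using AE by (intro integral_cong_AE borel_measurable_completion_AE_eq[OF g'] AE_completion
        measurable_completion g')
  also have "\<dots> = (\<integral>x. ?g x \<partial>M)"
    by (rule integral_completion[OF g'])
  finally have "ennreal (LINT x:A|completion M. f x) = ennreal (\<integral>x. ?g x \<partial>M)"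
    by simp
  also have "\<dots> = (\<integral>\<^sup>+x. ennreal (?g x) \<partial>M)"
  proof (rule nn_integral_eq_integral[symmetric])
    show "integrable M ?g"
      using A bound g' by (intro integrableI_bounded_set[where A = A and B = B]) (auto simp: indicator_def)
    show "AE x in M. 0 \<le> ?g x"
      using bound by (auto simp: indicator_def)
  qed
  also have "\<dots> = (\<integral>\<^sup>+x. ennreal (g x) * indicator A x \<partial>M)"
    by (intro nn_integral_cong) (auto simp: indicator_def)
  finally show ?thesis .
qed

section \<open>Lebesgue measure on the unit interval and the unit square\<close>

abbreviation lborel01 :: "real measure" where
  "lborel01 \<equiv> restrict_space lborel {0..1}"

lemma prob_space_lborel01: "prob_space lborel01"
  by (rule prob_spaceI) (simp add: space_restrict_space emeasure_restrict_space)

lemma borel_measurable_lborel01_pair: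
  assumes "h \<in> borel_measurable (borel :: (real \<times> real) measure)"
  shows "h \<in> borel_measurable (lborel01 \<Otimes>\<^sub>M lborel01)"
proof -
  have id: "(\<lambda>x. x) \<in> measurable lborel01 borel"
    by (rule measurable_restrict_space1) simp
  have "(\<lambda>z. (fst z, snd z)) \<in> measurable (lborel01 \<Otimes>\<^sub>M lborel01) (borel \<Otimes>\<^sub>M borel)"
    using measurable_compose[OF measurable_fst id] measurable_compose[OF measurable_snd id]
    by (rule measurable_Pair)
  then have "(\<lambda>z. z) \<in> measurable (lborel01 \<Otimes>\<^sub>M lborel01) (borel :: (real \<times> real) measure)"
    by (simp add: borel_prod)
  from measurable_compose[OF this assms] show ?thesis .
qed

lemma nn_integral_lborel01_pair:
  assumes h: "h \<in> borel_measurable (borel :: (real \<times> real) measure)"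
  shows "(\<integral>\<^sup>+z. h z \<partial>(lborel01 \<Otimes>\<^sub>M lborel01)) = (\<integral>\<^sup>+z. h z * indicator ({0..1} \<times> {0..1}) z \<partial>lborel)"
proof -
  interpret U: prob_space lborel01 by (rule prob_space_lborel01)
  have "(\<integral>\<^sup>+z. h z \<partial>(lborel01 \<Otimes>\<^sub>M lborel01)) = (\<integral>\<^sup>+x. (\<integral>\<^sup>+y. h (x, y) \<partial>lborel01) \<partial>lborel01)"
    by (rule U.nn_integral_fst[symmetric]) (rule borel_measurable_lborel01_pair[OF h])
  also have "\<dots> = (\<integral>\<^sup>+x. (\<integral>\<^sup>+y. h (x, y) * indicator {0..1} y * indicator {0..1} x \<partial>lborel) \<partial>lborel)"
    using h by (simp add: nn_integral_restrict_space nn_integral_multc borel_prod[symmetric])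
  also have "\<dots> = (\<integral>\<^sup>+x. (\<integral>\<^sup>+y. h (x, y) * indicator ({0..1} \<times> {0..1}) (x, y) \<partial>lborel) \<partial>lborel)"
    by (intro nn_integral_cong) (auto simp: indicator_def)
  also have "\<dots> = (\<integral>\<^sup>+z. h z * indicator ({0..1} \<times> {0..1}) z \<partial>(lborel \<Otimes>\<^sub>M lborel))"
    using h by (intro lborel.nn_integral_fst) (simp add: borel_prod[symmetric])
  finally show ?thesis
    by (simp add: lborel_prod)
qed

text \<open>The exceptions in the square lie in a Borel null set, and the integral of its indicator
  over the product is at most its Lebesgue measure in the plane.\<close>

lemma AE_lborel01_pair:
  assumes "AE z in lborel. z \<in> {0..1} \<times> {0..1} \<longrightarrow> Q z"
  shows "AE z in lborel01 \<Otimes>\<^sub>M lborel01. Q z"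
proof -
  obtain N where N: "N \<in> null_sets lborel" "{z \<in> space lborel. \<not> (z \<in> {0..1} \<times> {0..1} \<longrightarrow> Q z)} \<subseteq> N"
    using assms unfolding eventually_ae_filter by blast
  have [measurable]: "N \<in> sets borel"
    using N(1) by auto
  have ind: "indicator N \<in> borel_measurable (borel :: (real \<times> real) measure)"
    by measurable
  have "(\<integral>\<^sup>+z. indicator N z \<partial>(lborel01 \<Otimes>\<^sub>M lborel01)) \<le> (\<integral>\<^sup>+z. indicator N z \<partial>lborel)"
    unfolding nn_integral_lborel01_pair[OF ind] by (intro nn_integral_mono) (auto simp: indicator_def)
  also have "\<dots> = 0"
    using N(1) by (simp add: null_setsD1)
  finally have "AE z in lborel01 \<Otimes>\<^sub>M lborel01. indicator N z = (0 :: ennreal)"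
    by (subst (asm) le_zero_eq) (simp add: nn_integral_0_iff_AE borel_measurable_lborel01_pair[OF ind])
  moreover have "AE z in lborel01 \<Otimes>\<^sub>M lborel01. z \<in> {0..1} \<times> {0..1}"
    by (rule AE_I2) (auto simp: space_pair_measure space_restrict_space)
  ultimately show ?thesis
  proof eventually_elim
    case (elim z)
    then have "z \<notin> N"
      by (auto simp: indicator_def)
    then show ?case
      using elim N(2) by auto
  qed
qed

text \<open>The degree bound, known only almost everywhere for a Borel version of \<open>W\<close>, is made to hold
  everywhere by setting the majorant to \<open>0\<close> on the exceptional null set.\<close>

lemma kernel_majorant:
  fixes W :: "real \<Rightarrow> real \<Rightarrow> real"
  assumes W: "graphon W" and p: "0 \<le> p" "p \<le> 1"
    and deg: "\<And>x. x \<in> {0..1} \<Longrightarrow> (LINT y:{0..1}|lebesgue. W x y) \<le> d"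
  obtains g :: "real \<times> real \<Rightarrow> real" where "g \<in> borel_measurable borel" and "\<And>z. 0 \<le> g z"
    and "AE z in lborel01 \<Otimes>\<^sub>M lborel01. \<bar>W (fst z) (snd z) - p\<bar> \<le> g z"
    and "\<And>x. (\<integral>\<^sup>+y. g (x, y) \<partial>lborel01) \<le> ennreal (d + p)"
    and "(\<integral>\<^sup>+z. g z \<partial>(lborel01 \<Otimes>\<^sub>M lborel01)) \<le> ennreal (mean_abs (\<lambda>x y. W x y - p))"
proof -
  interpret U: prob_space lborel01 by (rule prob_space_lborel01)
  interpret UU: pair_sigma_finite lborel01 lborel01 ..
  let ?S = "{0..1} \<times> {0..1} :: (real \<times> real) set"
  have S: "?S \<in> sets borel" "emeasure lborel ?S < \<infinity>"
  proof -
    have "compact ?S"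
      by (intro compact_Times compact_Icc)
    then show "?S \<in> sets borel" "emeasure lborel ?S < \<infinity>"
      by (rule borel_compact, rule emeasure_bounded_finite[OF compact_imp_bounded])
  qed
  have W01: "W x y \<in> {0..1}" if "x \<in> {0..1}" "y \<in> {0..1}" for x y
    using W that by (auto simp: graphon_def)
  have "(\<lambda>(x, y). W x y) \<in> borel_measurable (lebesgue_on ?S)"
    using W by (simp add: graphon_def symmetric_kernel_def)
  then have "(\<lambda>z. if z \<in> ?S then (\<lambda>(x, y). W x y) z else 0) \<in> borel_measurable lebesgue"
    using S(1) by (intro borel_measurable_if_I) auto
  then obtain w0 :: "real \<times> real \<Rightarrow> real" where w0: "w0 \<in> borel_measurable lborel"
    and eq0: "AE z in lborel. (if z \<in> ?S then (\<lambda>(x, y). W x y) z else 0) = w0 z"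
    using completion_ex_borel_measurable_real by blast
  \<comment> \<open>Truncation makes the bounds hold everywhere and preserves agreement with
    \<open>W\<close> on the square, where \<open>W\<close> already lies between 0 and 1.\<close>
  define w where "w z = max 0 (min 1 (w0 z))" for z
  have w [measurable]: "w \<in> borel_measurable borel"
    using w0 unfolding w_def by (simp add: borel_measurable_max borel_measurable_min)
  have w01: "0 \<le> w z" "w z \<le> 1" for z
    by (auto simp: w_def)
  have eq: "AE z in lborel. z \<in> ?S \<longrightarrow> W (fst z) (snd z) = w z"
    using eq0
  proof eventually_elim
    case (elim z)
    show ?case
    proof
      assume z: "z \<in> ?S"
      then have "W (fst z) (snd z) \<in> {0..1}"
        by (intro W01) auto
      then show "W (fst z) (snd z) = w z"
        using elim z by (auto simp: w_def case_prod_beta)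
    qed
  qed
  define g0 where "g0 z = \<bar>w z - p\<bar>" for z
  have g0 [measurable]: "g0 \<in> borel_measurable borel"
    unfolding g0_def by measurable
  have section_measurable: "(\<lambda>y. f (x, y)) \<in> borel_measurable borel"
    if "f \<in> borel_measurable borel" for f :: "real \<times> real \<Rightarrow> real" and x
    using that by (simp add: borel_prod[symmetric])
  define B where "B x = (\<integral>\<^sup>+y. g0 (x, y) \<partial>lborel01)" for x
  have "B \<in> borel_measurable borel"
  proof -
    have "(\<lambda>x. \<integral>\<^sup>+y. ennreal (g0 (x, y)) * indicator {0..1} y \<partial>lborel) \<in> borel_measurable borel"
      using g0 unfolding borel_prod[symmetric] by measurable
    then show ?thesis
      unfolding B_def by (simp add: nn_integral_restrict_space)
  qed
  note [measurable] = this
  define g where "g z = (if B (fst z) \<le> ennreal (d + p) then g0 z else 0)" for z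
  have "AE x in lborel01. B x \<le> ennreal (d + p)"
  proof -
    \<comment> \<open>By Fubini, almost every section of \<open>W\<close> agrees almost everywhere
      with that of \<open>w\<close>; for such \<open>x\<close> the degree hypothesis on
      \<open>W\<close> transfers to \<open>w\<close>.\<close>
    have "AE x in lborel01. AE y in lborel01. W x y = w (x, y)"
      using UU.AE_pair[OF AE_lborel01_pair[OF eq]] by simp
    moreover have "AE x in lborel01. x \<in> {0..1}"
      by (rule AE_I2) (simp add: space_restrict_space)
    ultimately show ?thesis
    proof eventually_elim
      case (elim x)
      have wx: "(\<lambda>y. w (x, y)) \<in> borel_measurable lborel01"
        using section_measurable[OF w] by (intro measurable_restrict_space1) simp
      have "AE y in lborel. y \<in> {0..1} \<longrightarrow> W x y = w (x, y)"
        using elim(1) by (simp add: AE_restrict_space_iff)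
      then have "ennreal (LINT y:{0..1}|lebesgue. W x y) = (\<integral>\<^sup>+y. ennreal (w (x, y)) * indicator {0..1} y \<partial>lborel)"
        using section_measurable[OF w] w01 by (intro set_lebesgue_integral_completion[where B = 1]) auto
      then have int_w: "(\<integral>\<^sup>+y. ennreal (w (x, y)) \<partial>lborel01) = ennreal (LINT y:{0..1}|lebesgue. W x y)"
        by (simp add: nn_integral_restrict_space)
      \<comment> \<open>This yields \<open>0 \<le> d\<close>, needed to merge
        \<open>ennreal d + ennreal p\<close>, as \<open>ennreal\<close> truncates negative numbers
        to 0.\<close>
      have "0 \<le> (LINT y:{0..1}|lebesgue. W x y)"
        unfolding set_lebesgue_integral_def using W01[OF elim(2)]
        by (intro integral_nonneg_AE AE_I2) (auto simp: indicator_def)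
      then have "0 \<le> d"
        using deg[OF elim(2)] by linarith
      have "B x \<le> (\<integral>\<^sup>+y. ennreal (w (x, y)) + ennreal p \<partial>lborel01)"
        unfolding B_def g0_def using w01 p by (intro nn_integral_mono)
          (auto simp: ennreal_plus[symmetric] abs_if simp del: ennreal_plus intro!: ennreal_leI)
      also have "\<dots> = ennreal (LINT y:{0..1}|lebesgue. W x y) + ennreal p"
        using wx U.emeasure_space_1 by (simp add: nn_integral_add int_w space_restrict_space)
      also have "\<dots> \<le> ennreal d + ennreal p"
        using deg[OF elim(2)] by (intro add_right_mono ennreal_leI)
      also have "\<dots> = ennreal (d + p)"
        using \<open>0 \<le> d\<close> p by simp
      finally show ?case .
    qed
  qed
  then have "AE x in lborel01. AE y in lborel01. B (fst (x, y)) \<le> ennreal (d + p)"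
    by eventually_elim simp
  moreover have B_fst: "(\<lambda>z. B (fst z)) \<in> borel_measurable (borel :: (real \<times> real) measure)"
    unfolding borel_prod[symmetric] by measurable
  ultimately have AE_B: "AE z in lborel01 \<Otimes>\<^sub>M lborel01. B (fst z) \<le> ennreal (d + p)"
    using borel_measurable_lborel01_pair[OF B_fst] by (intro UU.AE_pair_measure) auto
  show thesis
  proof
    show "g \<in> borel_measurable borel"
      unfolding g_def using B_fst g0 by measurable
    show "0 \<le> g z" for z
      by (simp add: g_def g0_def)
    show "AE z in lborel01 \<Otimes>\<^sub>M lborel01. \<bar>W (fst z) (snd z) - p\<bar> \<le> g z"
      using AE_B AE_lborel01_pair[OF eq] by eventually_elim (simp add: g_def g0_def)
    show "(\<integral>\<^sup>+y. g (x, y) \<partial>lborel01) \<le> ennreal (d + p)" for x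
      by (cases "B x \<le> ennreal (d + p)") (auto simp: g_def B_def)
    have "(\<integral>\<^sup>+z. g z \<partial>(lborel01 \<Otimes>\<^sub>M lborel01)) \<le> (\<integral>\<^sup>+z. g0 z \<partial>(lborel01 \<Otimes>\<^sub>M lborel01))"
      by (intro nn_integral_mono) (auto simp: g_def g0_def)
    also have "\<dots> = (\<integral>\<^sup>+z. ennreal (g0 z) * indicator ?S z \<partial>lborel)"
      by (intro nn_integral_lborel01_pair) measurable
    also have "\<dots> = ennreal (mean_abs (\<lambda>x y. W x y - p))"
      unfolding mean_abs_def
    proof (rule set_lebesgue_integral_completion[where B = 1, symmetric])
      show "0 \<le> g0 z \<and> g0 z \<le> 1" for z
        using w01[of z] p by (auto simp: g0_def)
      show "AE z in lborel. z \<in> ?S \<longrightarrow> \<bar>W (fst z) (snd z) - p\<bar> = g0 z"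
        using eq by eventually_elim (auto simp: g0_def)
    qed (use S in auto)
    finally show "(\<integral>\<^sup>+z. g z \<partial>(lborel01 \<Otimes>\<^sub>M lborel01)) \<le> ennreal (mean_abs (\<lambda>x y. W x y - p))" .
  qed
qed

section \<open>Assembly of the combinatorial and analytic bounds\<close>

theorem theorem4p8:
  fixes V :: "'a set" and E :: "'a set set"
    and p \<epsilon> :: real and W U :: "real \<Rightarrow> real \<Rightarrow> real"
  assumes "simple_graph V E" and "no_isolated_vertices V E"
    and "0 \<le> p" and "p \<le> 1" and "0 \<le> \<epsilon>" and "\<epsilon> \<le> 1"
    and "graphon W"
    and "\<forall>x0\<in>{0..1}. (1 - \<epsilon>) * p \<le> (LINT y:{0..1}|lebesgue. W x0 y) \<and>
           (LINT y:{0..1}|lebesgue. W x0 y) \<le> (1 + \<epsilon>) * p"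
    and "U = (\<lambda>x y. W x y - p)"
  shows "Hom V E (\<lambda>x y. \<bar>U x y\<bar>) \<le>
     rpow ((2 + \<epsilon>) * p) (real (card V) - 2 * fractional_cover_number V E) *
     rpow (mean_abs U) (fractional_cover_number V E)"
proof -
  let ?F = "\<lambda>x y. \<bar>U x y\<bar>" and ?D = "(2 + \<epsilon>) * p" and ?M = "mean_abs U"
  let ?\<mu> = "Pi\<^sub>M V (\<lambda>_. lborel01)"
  obtain T \<pi> h where perm: "adj_permutation V E T \<pi>"
    and cover: "fractional_cover_number V E = real (card T) / 2"
    and h: "\<And>v. v \<in> V - T \<Longrightarrow> h v \<in> T \<and> {h v, v} \<in> E"
    using fractional_cover_number_eq[OF assms(1,2)] by blast
  have finV: "finite V" and edge: "\<And>e. e \<in> E \<Longrightarrow> e \<subseteq> V \<and> card e = 2"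
    using assms(1) by (auto simp: simple_graph_def)
  have TV: "T \<subseteq> V" and bij: "bij_betw \<pi> T T" and \<pi>E: "\<And>v. v \<in> T \<Longrightarrow> {v, \<pi> v} \<in> E"
    using perm by (auto simp: adj_permutation_def)
  have \<pi>T: "\<pi> v \<in> T" if "v \<in> T" for v
    using bij_betwE[OF bij] that by blast
  have hT: "h v \<in> T" "h v \<noteq> v" if "v \<in> V - T" for v
    using h[OF that] that by auto
  have \<pi>neq: "\<pi> v \<noteq> v" if "v \<in> T" for v
    using edge[OF \<pi>E[OF that]] by auto
  have M0: "0 \<le> ?M"
    unfolding mean_abs_def set_lebesgue_integral_def
    by (intro integral_nonneg_AE AE_I2) (auto simp: indicator_def)
  have D0: "0 \<le> ?D"
    using assms(3,5) by simp
  have deg: "(LINT y:{0..1}|lebesgue. W x y) \<le> (1 + \<epsilon>) * p" if "x \<in> {0..1}" for x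
    using assms(8) that by blast
  obtain g :: "real \<times> real \<Rightarrow> real" where g: "g \<in> borel_measurable borel" and g0: "\<And>z. 0 \<le> g z"
    and Ug: "AE z in lborel01 \<Otimes>\<^sub>M lborel01. \<bar>W (fst z) (snd z) - p\<bar> \<le> g z"
    and gD: "\<And>x. (\<integral>\<^sup>+y. g (x, y) \<partial>lborel01) \<le> ennreal ((1 + \<epsilon>) * p + p)"
    and gM: "(\<integral>\<^sup>+z. g z \<partial>(lborel01 \<Otimes>\<^sub>M lborel01)) \<le> ennreal (mean_abs (\<lambda>x y. W x y - p))"
    using kernel_majorant[OF assms(7,3,4) deg] by blast
  \<comment> \<open>The constant comes from \<open>\<bar>W - p\<bar> \<le> W + p\<close>: a degree
    of at most \<open>(1 + \<epsilon>) * p\<close>, plus \<open>p\<close>.\<close>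
  have D_eq: "(1 + \<epsilon>) * p + p = ?D"
    by (simp add: algebra_simps)
  let ?H = "\<lambda>x. (\<Prod>v\<in>V - T. g (x (h v), x v)) * (\<Prod>v\<in>T. sqrt (g (x v, x (\<pi> v))))"
  have AE_pair: "AE x in ?\<mu>. \<bar>W (x u) (x v) - p\<bar> \<le> g (x u, x v)" if "u \<in> V" "v \<in> V" "u \<noteq> v" for u v
  proof -
    have meas: "(\<lambda>x. (x u, x v)) \<in> measurable ?\<mu> (lborel01 \<Otimes>\<^sub>M lborel01)"
      by (intro measurable_Pair measurable_component_singleton that)
    have "AE z in distr ?\<mu> (lborel01 \<Otimes>\<^sub>M lborel01) (\<lambda>x. (x u, x v)). \<bar>W (fst z) (snd z) - p\<bar> \<le> g z"
      unfolding distr_PiM_two_components[OF prob_space_lborel01 that] by (rule Ug)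
    from AE_distrD[OF meas this] show ?thesis
      by simp
  qed
  have "AE x in ?\<mu>. \<forall>v\<in>V - T. \<bar>W (x (h v)) (x v) - p\<bar> \<le> g (x (h v), x v)"
    using hT TV finV by (intro AE_finite_allI AE_pair) auto
  moreover have "AE x in ?\<mu>. \<forall>v\<in>T. \<bar>W (x v) (x (\<pi> v)) - p\<bar> \<le> g (x v, x (\<pi> v))"
    using \<pi>T \<pi>neq[symmetric] TV finite_subset[OF TV finV] by (intro AE_finite_allI AE_pair) auto
  moreover have "AE x in ?\<mu>. x \<in> V \<rightarrow>\<^sub>E {0..1}"
    by (rule AE_I2) (simp add: space_PiM space_restrict_space)
  ultimately have "AE x in ?\<mu>. (\<Prod>e\<in>E. edge_factor ?F x e) \<le> ?H x"
  proof eventually_elim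
    case (elim x)
    have x01: "x v \<in> {0..1}" if "v \<in> V" for v
      using elim(3) that by auto
    have factor: "edge_factor ?F x {u, v} = \<bar>W (x u) (x v) - p\<bar>" if "{u, v} \<in> E" for u v
    proof -
      have uv: "u \<in> V" "v \<in> V" "u \<noteq> v"
        using edge[OF that] by auto
      have "W (x u) (x v) = W (x v) (x u)"
        using assms(7) x01[OF uv(1)] x01[OF uv(2)] by (simp add: graphon_def symmetric_kernel_def)
      then show ?thesis
        using uv(3) by (subst edge_factor_eq) (simp_all add: assms(9))
    qed
    have "0 \<le> edge_factor ?F x e \<and> edge_factor ?F x e \<le> 1" if e: "e \<in> E" for e
    proof -
      obtain u v where uv: "e = {u, v}" "u \<in> V" "v \<in> V"
        using edge[OF e] by (auto simp: card_2_iff)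
      \<comment> \<open>Both \<open>W\<close> and \<open>p\<close> lie between 0 and 1, so every
        edge factor is at most 1, as dropping edges requires.\<close>
      have "W (x u) (x v) \<in> {0..1}"
        using assms(7) x01[OF uv(2)] x01[OF uv(3)] by (simp add: graphon_def)
      then show ?thesis
        using factor[of u v] e uv(1) assms(3,4) by auto
    qed
    then have "(\<Prod>e\<in>E. edge_factor ?F x e)
      \<le> (\<Prod>v\<in>V - T. edge_factor ?F x {h v, v}) * (\<Prod>v\<in>T. sqrt (edge_factor ?F x {v, \<pi> v}))"
      by (intro prod_edges_le[OF assms(1) perm h])
    also have "\<dots> = (\<Prod>v\<in>V - T. \<bar>W (x (h v)) (x v) - p\<bar>) * (\<Prod>v\<in>T. sqrt \<bar>W (x v) (x (\<pi> v)) - p\<bar>)"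
      using h \<pi>E by (intro arg_cong2[where f = "(*)"] prod.cong refl) (auto simp: factor)
    also have "\<dots> \<le> ?H x"
      using elim(1,2) g0 by (intro mult_mono prod_mono conjI prod_nonneg) auto
    finally show ?case .
  qed
  then have "AE x in ?\<mu>. ennreal (\<Prod>e\<in>E. edge_factor ?F x e) \<le> ennreal (?H x)"
    by eventually_elim (rule ennreal_leI)
  then have "(\<integral>\<^sup>+x. ennreal (\<Prod>e\<in>E. edge_factor ?F x e) \<partial>?\<mu>) \<le> (\<integral>\<^sup>+x. ennreal (?H x) \<partial>?\<mu>)"
    by (rule nn_integral_mono_AE)
  also have "\<dots> = (\<integral>\<^sup>+x. (\<Prod>v\<in>V - T. ennreal (g (x (h v), x v)))
      * (\<Prod>v\<in>T. ennreal_sqrt (ennreal (g (x v, x (\<pi> v))))) \<partial>?\<mu>)"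
    using g0 by (simp add: ennreal_mult prod_nonneg prod_ennreal)
  also have "\<dots> \<le> ennreal ?D ^ card (V - T)
      * ennreal_sqrt (\<integral>\<^sup>+z. ennreal (g z) \<partial>(lborel01 \<Otimes>\<^sub>M lborel01)) ^ card T"
    using borel_measurable_lborel01_pair[of "\<lambda>z. ennreal (g z)"] g h gD unfolding D_eq
    by (intro nn_integral_prod_pendant_le prob_space_lborel01 finV TV bij \<pi>neq) auto
  also have "\<dots> \<le> ennreal ?D ^ card (V - T) * ennreal_sqrt (ennreal ?M) ^ card T"
    using gM by (intro mult_left_mono power_mono ennreal_sqrt_mono) (auto simp: assms(9))
  also have "\<dots> = ennreal (?D ^ card (V - T) * sqrt ?M ^ card T)"
    using M0 D0 by (simp add: ennreal_power ennreal_mult)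
  \<comment> \<open>Completion does not change the nonnegative integral, and a bound on it passes to
    the Bochner integral, which is 0 by default if the integrand is not integrable.\<close>
  finally have "Hom V E ?F \<le> ?D ^ card (V - T) * sqrt ?M ^ card T"
    unfolding Hom_def using M0 D0 by (intro integral_real_bounded) (auto simp: nn_integral_completion)
  also have "?D ^ card (V - T) = rpow ?D (real (card V) - 2 * fractional_cover_number V E)"
  proof -
    \<comment> \<open>The exponent is a natural number, so the real power is an ordinary one; if it
      vanishes, \<open>rpow\<close> gives 1 even for base 0.\<close>
    have "real (card V) - 2 * fractional_cover_number V E = real (card (V - T))"
      using card_mono[OF finV TV] by (simp add: cover card_Diff_subset[OF finite_subset[OF TV finV] TV])
    then show ?thesis
      using D0 by (cases "card (V - T) = 0") (auto simp: rpow_def powr_realpow')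
  qed
  also have "sqrt ?M ^ card T = rpow ?M (fractional_cover_number V E)"
  proof (cases "card T = 0")
    case False
    have "sqrt ?M ^ card T = (?M powr (1 / 2)) powr real (card T)"
      using False M0 by (simp add: powr_half_sqrt powr_realpow')
    then show ?thesis
      using False by (simp add: cover rpow_def powr_powr)
  qed (simp add: cover rpow_def)
  finally show ?thesis .
qed

end
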